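(* Let $H$ be a real Hilbert space and $f:H\to\mathbb{R}\cup\{+\infty\}$ a proper lower semicontinuous convex function whose solution set $S:=(\partial f)^{-1}(0)$ is nonempty. Let $f^*:=\min_H f$ and let $\tilde{x}$ be the least-norm element of $S$. Suppose that $(\partial f)^{-1}$ is truncately $R$-continuous at $0$ with modulus function $\rho$. For $\varepsilon>0$ let $x_\varepsilon:=(\partial f+\varepsilon\, Id)^{-1}(0)$, i.e. $x_\varepsilon$ is the unique minimizer of $f+\frac{\varepsilon}{2}\Vert\cdot\Vert^2$. Then for all sufficiently small $\varepsilon>0$, $$f(x_\varepsilon)-f^*\le\Vert\tilde{x}\Vert\,\rho(\varepsilon\Vert\tilde{x}\Vert)\,\varepsilon.$$
   Context: $\partial f$ is the subdifferential of convex analysis, and $(\partial f)^{-1}(y)=\{x: y\in\partial f(x)\}$. $\mathbb{B}$ is the closed unit ball of $H$, $\mathbb{R}^+=[0,\infty)$. A set-valued operator $\mathcal{A}:H\rightrightarrows H$ with $\mathcal{A}(0)\ne\emptyset$ is called truncately $R$-continuous at $0$ with (continuity) modulus function $\rho$ if there exist $\sigma>0$ and a non-decreasing function $\rho:\mathbb{R}^+\to\mathbb{R}^+$ with $\lim_{r\to0^+}\rho(r)=\rho(0)=0$ such that $\mathcal{A}(x)\cap a\mathbb{B}\subset\mathcal{A}(0)+\rho(\Vert x\Vert)\mathbb{B}$ for all $x\in\sigma\mathbb{B}$, where $a=\inf_{y\in\mathcal{A}(0)}\Vert y\Vert$. *)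

theory Defs
  imports "HOL-Analysis.Analysis"
begin

(* Functions with values in the reals or +infinity are ereal-valued functions
   that avoid -infinity; this requirement is part of properness. *)

definition proper_fun :: "('a \<Rightarrow> ereal) \<Rightarrow> bool"
  where "proper_fun f \<longleftrightarrow> (\<forall>x. f x \<noteq> -\<infinity>) \<and> (\<exists>x. f x \<noteq> \<infinity>)"

definition lsc_fun :: "('a::topological_space \<Rightarrow> ereal) \<Rightarrow> bool"
  where "lsc_fun f \<longleftrightarrow> (\<forall>x. f x \<le> Liminf (at x) f)"

(* In ereal, 0 * \<infinity> = 0, so the degenerate cases u = 0 and v = 0 are trivially true. *)
definition convex_fun :: "('a::real_vector \<Rightarrow> ereal) \<Rightarrow> bool"
  where "convex_fun f \<longleftrightarrow>
    (\<forall>x y. \<forall>u\<ge>0. \<forall>v\<ge>0. u + v = 1 \<longrightarrow>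
       f (u *\<^sub>R x + v *\<^sub>R y) \<le> ereal u * f x + ereal v * f y)"

definition subdifferential :: "('a::real_inner \<Rightarrow> ereal) \<Rightarrow> 'a \<Rightarrow> 'a set"
  where "subdifferential f x =
    {v. f x \<noteq> \<infinity> \<and> (\<forall>y. f x + ereal (v \<bullet> (y - x)) \<le> f y)}"

definition op_inverse :: "('a \<Rightarrow> 'b set) \<Rightarrow> 'b \<Rightarrow> 'a set"
  where "op_inverse A y = {x. y \<in> A x}"

(* The modulus is only relevant on [0,\<infinity>); the sum of sets is the Minkowski sum,
   and cball 0 r is r times the closed unit ball for r \<ge> 0. *)
definition truncately_R_continuous_at_0 ::
    "('a::real_normed_vector \<Rightarrow> 'b::real_normed_vector set) \<Rightarrow> (real \<Rightarrow> real) \<Rightarrow> bool"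
  where "truncately_R_continuous_at_0 A \<rho> \<longleftrightarrow>
    A 0 \<noteq> {} \<and>
    (\<forall>r\<ge>0. 0 \<le> \<rho> r) \<and> mono_on {0..} \<rho> \<and> \<rho> 0 = 0 \<and> (\<rho> \<longlongrightarrow> 0) (at_right 0) \<and>
    (\<exists>\<sigma>>0. \<forall>x \<in> cball 0 \<sigma>.
       A x \<inter> cball 0 (INF y\<in>A 0. norm y) \<subseteq> A 0 + cball 0 (\<rho> (norm x)))"

definition least_norm_element :: "'a::real_normed_vector set \<Rightarrow> 'a"
  where "least_norm_element S = (THE x. is_arg_min norm (\<lambda>y. y \<in> S) x)"

(* The unique element of (\<partial>f + \<epsilon> Id)^{-1}(0). *)
definition tikhonov_point :: "('a::real_inner \<Rightarrow> ereal) \<Rightarrow> real \<Rightarrow> 'a"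
  where "tikhonov_point f \<epsilon> =
    (THE x. x \<in> op_inverse (\<lambda>y. subdifferential f y + {\<epsilon> *\<^sub>R y}) 0)"

definition min_value :: "('a \<Rightarrow> ereal) \<Rightarrow> ereal"
  where "min_value f = (LEAST v. v \<in> range f)"

end

theory Submission
  imports Defs
begin

text \<open>
  The regularized functional \<open>f + \<epsilon>/2 \<parallel>\<cdot>\<parallel>\<^sup>2\<close> is strongly convex. By the midpoint inequality
  every minimizing sequence is Cauchy, so completeness and lower semicontinuity give a minimizer, and
  the same inequality makes it unique (\<open>tikhonov_functional_ex1_minimizer\<close>). Comparing the minimizer
  \<open>x\<close> with points \<open>x + t(y - x)\<close> and letting \<open>t\<close> tend to 0 turns minimality into the inclusion
  \<open>-\<epsilon>x \<in> \<partial>f(x)\<close> (\<open>is_arg_min_tikhonov_functional_iff\<close>). Hence both descriptions of the Tikhonov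
  point agree. Applied to the indicator function of a closed convex set, the same
  existence and uniqueness statement yields its least-norm element.

  For the estimate, let \<open>x\<close> be the Tikhonov point. Since the least-norm solution \<open>xt\<close> minimizes \<open>f\<close>, comparing the
  regularized values at \<open>x\<close> and \<open>xt\<close> gives \<open>\<parallel>x\<parallel> \<le> \<parallel>xt\<parallel>\<close>. So \<open>x\<close> lies in the truncated value
  of \<open>(\<partial>f)\<^sup>-\<^sup>1\<close> at \<open>-\<epsilon>x\<close>, a point that enters the ball of radius \<open>\<sigma>\<close> once \<open>\<epsilon>\<parallel>xt\<parallel> \<le> \<sigma>\<close>.
  The continuity hypothesis then provides a solution \<open>s\<close> with
  \<open>\<parallel>x - s\<parallel> \<le> \<rho>(\<epsilon>\<parallel>x\<parallel>) \<le> \<rho>(\<epsilon>\<parallel>xt\<parallel>)\<close>, and the subgradient inequality at \<open>x\<close>, tested at \<open>s\<close>,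
  reads \<open>f(x) - f(s) \<le> \<epsilon> \<langle>x, s - x\<rangle>\<close>; Cauchy-Schwarz finishes the proof.
\<close>

section \<open>Lower semicontinuity and convexity of extended-real functions\<close>

lemma lsc_fun_sequentially:
  fixes f :: "'a::topological_space \<Rightarrow> ereal"
  assumes "lsc_fun f" and "X \<longlonglongrightarrow> x" and "c \<longlonglongrightarrow> L"
    and le: "\<And>n. f (X n) \<le> ereal (c n)"
  shows "f x \<le> ereal L"
proof (rule ccontr)
  assume "\<not> f x \<le> ereal L"
  then obtain r where r: "ereal L < ereal r" "ereal r < f x"
    using ereal_dense2[of "ereal L" "f x"] by (auto simp: not_le)
  have "f x \<le> Liminf (at x) f"
    using assms(1) by (simp add: lsc_fun_def)
  then have "\<forall>\<^sub>F y in at x. ereal r < f y"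
    using r(2) by (simp add: le_Liminf_iff)
  then have "\<forall>\<^sub>F y in nhds x. ereal r < f y"
    using r(2) by (auto simp: eventually_at_filter elim: eventually_mono)
  then have "\<forall>\<^sub>F n in sequentially. ereal r < f (X n)"
    using assms(2) by (rule eventually_compose_filterlim)
  moreover have "\<forall>\<^sub>F n in sequentially. c n < r"
    using assms(3) r(1) by (intro order_tendstoD) auto
  ultimately have "\<forall>\<^sub>F n in sequentially. False"
  proof eventually_elim
    case (elim n)
    then have "ereal r < ereal (c n)"
      using le[of n] by (meson less_le_trans)
    then show ?case using elim by simp
  qed
  then show False by simp
qed

lemma convex_fun_real_bound:
  assumes "convex_fun f" and "f x = ereal a" and "f y = ereal b"
    and "0 \<le> u" "0 \<le> v" "u + v = 1"
  shows "f (u *\<^sub>R x + v *\<^sub>R y) \<le> ereal (u * a + v * b)"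
proof -
  have "f (u *\<^sub>R x + v *\<^sub>R y) \<le> ereal u * f x + ereal v * f y"
    using assms unfolding convex_fun_def by blast
  then show ?thesis by (simp add: assms(2,3))
qed

lemma closed_sublevel_lsc_fun:
  fixes f :: "'a::real_normed_vector \<Rightarrow> ereal"
  assumes "lsc_fun f"
  shows "closed {x. f x \<le> ereal m}"
  unfolding closed_sequential_limits
  using lsc_fun_sequentially[OF assms _ tendsto_const[of m]] by auto

lemma convex_sublevel_convex_fun:
  assumes "convex_fun f"
  shows "convex {x. f x \<le> ereal m}"
proof (rule convexI, clarsimp)
  fix x y and u v :: real
  assume *: "f x \<le> ereal m" "f y \<le> ereal m" "0 \<le> u" "0 \<le> v" "u + v = 1"
  have "f (u *\<^sub>R x + v *\<^sub>R y) \<le> ereal u * f x + ereal v * f y"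
    using assms * unfolding convex_fun_def by blast
  also have "\<dots> \<le> ereal u * ereal m + ereal v * ereal m"
    using * by (intro add_mono ereal_mult_left_mono) auto
  also have "\<dots> = ereal ((u + v) * m)"
    by (simp add: distrib_right)
  finally show "f (u *\<^sub>R x + v *\<^sub>R y) \<le> ereal m"
    using * by simp
qed

section \<open>The regularized functional\<close>

definition tikhonov_functional :: "('a::real_inner \<Rightarrow> ereal) \<Rightarrow> real \<Rightarrow> 'a \<Rightarrow> ereal"
  where "tikhonov_functional f \<epsilon> y = f y + ereal (\<epsilon> / 2 * (norm y)\<^sup>2)"

text \<open>
  Strong convexity: the parallelogram identity supplies the gain \<open>\<epsilon>/8 \<parallel>x - y\<parallel>\<^sup>2\<close> over
  ordinary midpoint convexity.
\<close>

lemma tikhonov_functional_midpoint: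
  assumes "convex_fun f"
    and x: "tikhonov_functional f \<epsilon> x = ereal a" and y: "tikhonov_functional f \<epsilon> y = ereal b"
  shows "tikhonov_functional f \<epsilon> ((1/2) *\<^sub>R x + (1/2) *\<^sub>R y)
           \<le> ereal ((a + b) / 2 - \<epsilon> / 8 * (norm (x - y))\<^sup>2)"
proof -
  have fx: "f x = ereal (a - \<epsilon> / 2 * (norm x)\<^sup>2)"
    using x by (cases "f x") (auto simp: tikhonov_functional_def)
  have fy: "f y = ereal (b - \<epsilon> / 2 * (norm y)\<^sup>2)"
    using y by (cases "f y") (auto simp: tikhonov_functional_def)
  let ?z = "(1/2) *\<^sub>R x + (1/2) *\<^sub>R y"
  have "(norm ?z)\<^sup>2 = ((norm x)\<^sup>2 + (norm y)\<^sup>2) / 2 - (norm (x - y))\<^sup>2 / 4"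
    unfolding power2_norm_eq_inner
    by (simp add: inner_left_distrib inner_right_distrib inner_diff_left inner_diff_right
        inner_commute field_simps)
  then have nz: "\<epsilon> / 2 * (norm ?z)\<^sup>2
      = \<epsilon> / 2 * (((norm x)\<^sup>2 + (norm y)\<^sup>2) / 2 - (norm (x - y))\<^sup>2 / 4)"
    by (rule arg_cong)
  have eq: "1/2 * (a - \<epsilon> / 2 * (norm x)\<^sup>2) + 1/2 * (b - \<epsilon> / 2 * (norm y)\<^sup>2)
      + \<epsilon> / 2 * (norm ?z)\<^sup>2 = (a + b) / 2 - \<epsilon> / 8 * (norm (x - y))\<^sup>2"
    unfolding nz by (simp add: field_simps)
  have "f ?z \<le> ereal (1/2 * (a - \<epsilon> / 2 * (norm x)\<^sup>2) + 1/2 * (b - \<epsilon> / 2 * (norm y)\<^sup>2))"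
    by (rule convex_fun_real_bound[OF assms(1) fx fy]) auto
  then have "tikhonov_functional f \<epsilon> ?z
      \<le> ereal (1/2 * (a - \<epsilon> / 2 * (norm x)\<^sup>2) + 1/2 * (b - \<epsilon> / 2 * (norm y)\<^sup>2))
        + ereal (\<epsilon> / 2 * (norm ?z)\<^sup>2)"
    unfolding tikhonov_functional_def by (rule add_right_mono)
  then show ?thesis by (simp only: plus_ereal.simps eq)
qed

text \<open>
  The value at the midpoint stays above \<open>I\<close>, so the strong convexity gain cannot exceed \<open>d\<close>.
  When \<open>I\<close> is the infimum and \<open>d\<close> tends to 0, this makes minimizing sequences Cauchy; with
  \<open>d = 0\<close> it is uniqueness of minimizers.
\<close>

lemma tikhonov_functional_near_minimizers:
  assumes "convex_fun f" and low: "\<And>z. ereal I \<le> tikhonov_functional f \<epsilon> z"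
    and x: "tikhonov_functional f \<epsilon> x \<le> ereal (I + d)"
    and y: "tikhonov_functional f \<epsilon> y \<le> ereal (I + d)"
  shows "\<epsilon> / 8 * (norm (x - y))\<^sup>2 \<le> d"
proof -
  obtain a where a: "tikhonov_functional f \<epsilon> x = ereal a" "a \<le> I + d"
    using x low[of x] by (cases "tikhonov_functional f \<epsilon> x") auto
  obtain b where b: "tikhonov_functional f \<epsilon> y = ereal b" "b \<le> I + d"
    using y low[of y] by (cases "tikhonov_functional f \<epsilon> y") auto
  have "ereal I \<le> ereal ((a + b) / 2 - \<epsilon> / 8 * (norm (x - y))\<^sup>2)"
    using tikhonov_functional_midpoint[OF assms(1) a(1) b(1)] low by (meson order_trans)
  then have "I \<le> (a + b) / 2 - \<epsilon> / 8 * (norm (x - y))\<^sup>2"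
    by (simp only: ereal_less_eq)
  moreover have "(a + b) / 2 \<le> I + d" using a(2) b(2) by simp
  ultimately have "I \<le> I + d - \<epsilon> / 8 * (norm (x - y))\<^sup>2"
    by (meson diff_right_mono order_trans)
  then show ?thesis by (simp add: algebra_simps)
qed

lemma tikhonov_functional_ex1_minimizer:
  fixes f :: "'a::{real_inner, complete_space} \<Rightarrow> ereal"
  assumes pr: "proper_fun f" and lsc: "lsc_fun f" and cv: "convex_fun f"
    and bound: "\<And>x. ereal m \<le> f x" and e: "\<epsilon> > 0"
  shows "\<exists>!x. is_arg_min (tikhonov_functional f \<epsilon>) (\<lambda>_. True) x"
proof -
  let ?F = "tikhonov_functional f \<epsilon>"
  obtain w where w: "f w \<noteq> \<infinity>" using pr by (auto simp: proper_fun_def)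
  have Fm: "ereal m \<le> ?F x" for x
  proof -
    have "ereal m + ereal 0 \<le> f x + ereal (\<epsilon> / 2 * (norm x)\<^sup>2)"
      using e by (intro add_mono bound) auto
    then show ?thesis by (simp add: tikhonov_functional_def)
  qed
  have Infm: "ereal m \<le> (INF x. ?F x)" by (intro INF_greatest Fm)
  have "(INF x. ?F x) \<le> ?F w" by (rule INF_lower) simp
  moreover have "?F w \<noteq> \<infinity>" using w by (auto simp: tikhonov_functional_def)
  ultimately obtain I where I: "(INF x. ?F x) = ereal I"
    using Infm by (cases "INF x. ?F x") auto
  have low: "ereal I \<le> ?F x" for x
    unfolding I[symmetric] by (rule INF_lower) simp
  have "\<exists>x. ?F x \<le> ereal (I + d)" if "d > 0" for d
  proof -
    have "(INF x. ?F x) < ereal (I + d)" using that I by simp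
    then show ?thesis unfolding INF_less_iff by (auto intro: less_imp_le)
  qed
  then have "\<exists>x. ?F x \<le> ereal (I + inverse (real (Suc n)))" for n
    by simp
  then obtain X where X: "\<And>n. ?F (X n) \<le> ereal (I + inverse (real (Suc n)))"
    by metis
  have "Cauchy X"
  proof (rule metric_CauchyI)
    fix r :: real assume r: "r > 0"
    then obtain N where N: "inverse (real (Suc N)) < \<epsilon> / 8 * r\<^sup>2"
      using e reals_Archimedean[of "\<epsilon> / 8 * r\<^sup>2"] by auto
    have "dist (X i) (X j) < r" if "i \<ge> N" "j \<ge> N" for i j
    proof -
      have XN: "?F (X k) \<le> ereal (I + inverse (real (Suc N)))" if "k \<ge> N" for k
      proof -
        have "inverse (real (Suc k)) \<le> inverse (real (Suc N))"
          using that by (intro le_imp_inverse_le) auto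
        then have "ereal (I + inverse (real (Suc k))) \<le> ereal (I + inverse (real (Suc N)))"
          by simp
        with X[of k] show ?thesis by (rule order_trans)
      qed
      have "\<epsilon> / 8 * (norm (X i - X j))\<^sup>2 \<le> inverse (real (Suc N))"
        using tikhonov_functional_near_minimizers[OF cv low XN XN] that by blast
      with N have "\<epsilon> / 8 * (norm (X i - X j))\<^sup>2 < \<epsilon> / 8 * r\<^sup>2" by linarith
      then have "(norm (X i - X j))\<^sup>2 < r\<^sup>2"
        using e by (simp add: mult_less_cancel_left_pos)
      then show ?thesis
        using r by (auto simp: dist_norm dest: power2_less_imp_less)
    qed
    then show "\<exists>M. \<forall>i\<ge>M. \<forall>j\<ge>M. dist (X i) (X j) < r" by blast
  qed
  then obtain x where lim: "X \<longlonglongrightarrow> x"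
    using Cauchy_convergent convergent_def by blast
  \<comment> \<open>Only \<open>f\<close> is semicontinuous by hypothesis, so the convergent quadratic term moves into the bound.\<close>
  have "f x \<le> ereal (I + 0 - \<epsilon> / 2 * (norm x)\<^sup>2)"
  proof (rule lsc_fun_sequentially[OF lsc lim])
    show "(\<lambda>n. I + inverse (real (Suc n)) - \<epsilon> / 2 * (norm (X n))\<^sup>2)
        \<longlonglongrightarrow> I + 0 - \<epsilon> / 2 * (norm x)\<^sup>2"
      by (intro tendsto_intros lim LIMSEQ_inverse_real_of_nat)
    show "f (X n) \<le> ereal (I + inverse (real (Suc n)) - \<epsilon> / 2 * (norm (X n))\<^sup>2)" for n
      using X[of n] by (cases "f (X n)") (auto simp: tikhonov_functional_def algebra_simps)
  qed
  then have Fx: "?F x \<le> ereal I"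
    by (cases "f x") (auto simp: tikhonov_functional_def)
  show ?thesis
  proof (rule ex1I)
    show "is_arg_min ?F (\<lambda>_. True) x"
      using order_trans[OF Fx low] by (simp add: is_arg_min_linorder)
  next
    fix y assume "is_arg_min ?F (\<lambda>_. True) y"
    then have "?F y \<le> ereal I"
      using Fx by (auto simp: is_arg_min_linorder intro: order_trans)
    then have "\<epsilon> / 8 * (norm (y - x))\<^sup>2 \<le> 0"
      using Fx by (intro tikhonov_functional_near_minimizers[OF cv low]) auto
    then show "y = x" using e by (simp add: mult_le_0_iff)
  qed
qed

text \<open>
  Fermat's rule for the regularized functional. Convexity of the square gives the direction from
  the subgradient to minimality. Conversely, moving from the minimizer towards \<open>y\<close> by a fraction
  \<open>t\<close> gives the subgradient inequality up to the error \<open>t \<epsilon>/2 \<parallel>y - x\<parallel>\<^sup>2\<close>, which vanishes with \<open>t\<close>.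
\<close>

lemma is_arg_min_tikhonov_functional_iff:
  assumes pr: "proper_fun f" and cv: "convex_fun f" and e: "\<epsilon> > 0"
  shows "is_arg_min (tikhonov_functional f \<epsilon>) (\<lambda>_. True) x \<longleftrightarrow> - (\<epsilon> *\<^sub>R x) \<in> subdifferential f x"
proof
  assume "- (\<epsilon> *\<^sub>R x) \<in> subdifferential f x"
  then have sub: "f x + ereal (- (\<epsilon> *\<^sub>R x) \<bullet> (y - x)) \<le> f y" for y
    by (simp add: subdifferential_def)
  have "tikhonov_functional f \<epsilon> x \<le> tikhonov_functional f \<epsilon> y" for y
  proof -
    have "0 \<le> \<epsilon> / 2 * (norm (y - x))\<^sup>2" using e by simp
    also have "(norm (y - x))\<^sup>2 = (norm y)\<^sup>2 - (norm x)\<^sup>2 - 2 * (x \<bullet> (y - x))"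
      unfolding power2_norm_eq_inner by (simp add: inner_diff_left inner_diff_right inner_commute)
    finally have "\<epsilon> / 2 * (norm x)\<^sup>2 \<le> - (\<epsilon> *\<^sub>R x) \<bullet> (y - x) + \<epsilon> / 2 * (norm y)\<^sup>2"
      by (simp add: algebra_simps)
    then have "f x + ereal (\<epsilon> / 2 * (norm x)\<^sup>2)
        \<le> f x + ereal (- (\<epsilon> *\<^sub>R x) \<bullet> (y - x) + \<epsilon> / 2 * (norm y)\<^sup>2)"
      by (intro add_left_mono) simp
    also have "\<dots> = f x + ereal (- (\<epsilon> *\<^sub>R x) \<bullet> (y - x)) + ereal (\<epsilon> / 2 * (norm y)\<^sup>2)"
      by (simp add: add.assoc)
    also have "\<dots> \<le> f y + ereal (\<epsilon> / 2 * (norm y)\<^sup>2)"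
      by (intro add_right_mono sub)
    finally show ?thesis by (simp add: tikhonov_functional_def)
  qed
  then show "is_arg_min (tikhonov_functional f \<epsilon>) (\<lambda>_. True) x"
    by (simp add: is_arg_min_linorder)
next
  assume "is_arg_min (tikhonov_functional f \<epsilon>) (\<lambda>_. True) x"
  then have min: "tikhonov_functional f \<epsilon> x \<le> tikhonov_functional f \<epsilon> y" for y
    by (simp add: is_arg_min_linorder)
  obtain w where w: "f w \<noteq> \<infinity>" using pr by (auto simp: proper_fun_def)
  have ninf: "f y \<noteq> -\<infinity>" for y using pr by (simp add: proper_fun_def)
  have "f x \<noteq> \<infinity>"
    using min[of w] w by (auto simp: tikhonov_functional_def)
  then obtain a where a: "f x = ereal a" using ninf[of x] by (cases "f x") auto
  have "f x + ereal (- (\<epsilon> *\<^sub>R x) \<bullet> (y - x)) \<le> f y" for y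
  proof (cases "f y = \<infinity>")
    case False
    then obtain b where b: "f y = ereal b" using ninf[of y] by (cases "f y") auto
    let ?p = "x \<bullet> (y - x)"
    have "a - b - \<epsilon> * ?p \<le> \<epsilon> / 2 * (norm (y - x))\<^sup>2 * t" if t: "0 < t" "t < 1" for t
    proof -
      let ?z = "(1 - t) *\<^sub>R x + t *\<^sub>R y"
      have "f ?z \<le> ereal ((1 - t) * a + t * b)"
        using t by (intro convex_fun_real_bound[OF cv a b]) auto
      then have "tikhonov_functional f \<epsilon> ?z
          \<le> ereal ((1 - t) * a + t * b) + ereal (\<epsilon> / 2 * (norm ?z)\<^sup>2)"
        unfolding tikhonov_functional_def by (rule add_right_mono)
      with min[of ?z] have
        "ereal a + ereal (\<epsilon> / 2 * (norm x)\<^sup>2)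
          \<le> ereal ((1 - t) * a + t * b) + ereal (\<epsilon> / 2 * (norm ?z)\<^sup>2)"
        by (metis a order_trans tikhonov_functional_def)
      then have le: "a + \<epsilon> / 2 * (norm x)\<^sup>2 \<le> (1 - t) * a + t * b + \<epsilon> / 2 * (norm ?z)\<^sup>2"
        by simp
      have "?z = x + t *\<^sub>R (y - x)" by (simp add: algebra_simps)
      moreover have "(norm (x + t *\<^sub>R (y - x)))\<^sup>2
          = (norm x)\<^sup>2 + 2 * t * ?p + t\<^sup>2 * (norm (y - x))\<^sup>2"
        unfolding power2_norm_eq_inner
        by (simp add: inner_left_distrib inner_right_distrib inner_commute[of "y - x" x]
            power2_eq_square distrib_left del: inner_diff_left inner_diff_right)
      ultimately have "(norm ?z)\<^sup>2 = (norm x)\<^sup>2 + 2 * t * ?p + t\<^sup>2 * (norm (y - x))\<^sup>2"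
        by simp
      then have diff: "(norm ?z)\<^sup>2 - (norm x)\<^sup>2 = 2 * t * ?p + t\<^sup>2 * (norm (y - x))\<^sup>2"
        by linarith
      have "t * (a - b) \<le> \<epsilon> / 2 * ((norm ?z)\<^sup>2 - (norm x)\<^sup>2)"
        using le by (simp add: left_diff_distrib right_diff_distrib)
      also have "\<dots> = t * (\<epsilon> * ?p) + t * (\<epsilon> / 2 * (norm (y - x))\<^sup>2 * t)"
        unfolding diff by (simp add: distrib_left power2_eq_square)
      finally have "t * (a - b - \<epsilon> * ?p) \<le> t * (\<epsilon> / 2 * (norm (y - x))\<^sup>2 * t)"
        by (simp add: right_diff_distrib)
      then show ?thesis using t by (simp only: mult_le_cancel_left_pos)
    qed
    then have "\<forall>\<^sub>F t in at_right 0. a - b - \<epsilon> * ?p \<le> \<epsilon> / 2 * (norm (y - x))\<^sup>2 * t"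
      unfolding eventually_at_right_field using zero_less_one by blast
    moreover have "((\<lambda>t. \<epsilon> / 2 * (norm (y - x))\<^sup>2 * t) \<longlongrightarrow> \<epsilon> / 2 * (norm (y - x))\<^sup>2 * 0)
        (at_right 0)"
      by (intro tendsto_intros)
    ultimately have "a - b - \<epsilon> * ?p \<le> \<epsilon> / 2 * (norm (y - x))\<^sup>2 * 0"
      by (intro tendsto_lowerbound) auto
    then show ?thesis by (simp add: a b)
  qed simp
  then show "- (\<epsilon> *\<^sub>R x) \<in> subdifferential f x"
    using \<open>f x \<noteq> \<infinity>\<close> by (simp add: subdifferential_def)
qed

lemma op_inverse_regularized_subdifferential_iff:
  "x \<in> op_inverse (\<lambda>y. subdifferential f y + {\<epsilon> *\<^sub>R y}) 0 \<longleftrightarrow> - (\<epsilon> *\<^sub>R x) \<in> subdifferential f x"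
proof -
  have "0 = a + \<epsilon> *\<^sub>R x \<longleftrightarrow> a = - (\<epsilon> *\<^sub>R x)" for a
    using eq_neg_iff_add_eq_0[of a "\<epsilon> *\<^sub>R x"] by auto
  then show ?thesis by (simp add: op_inverse_def set_plus_def)
qed

section \<open>Least-norm elements of closed convex sets\<close>

text \<open>
  Adding \<open>\<parallel>\<cdot>\<parallel>\<^sup>2/2\<close> to the function that is 0 on \<open>C\<close> and \<open>\<infinity>\<close> elsewhere turns the least-norm
  problem over \<open>C\<close> into minimization of a regularized functional.
\<close>

lemma closed_convex_ex1_least_norm:
  fixes C :: "'a::{real_inner, complete_space} set"
  assumes "closed C" "convex C" "C \<noteq> {}"
  shows "\<exists>!x. is_arg_min norm (\<lambda>y. y \<in> C) x"
proof -
  define g :: "'a \<Rightarrow> ereal" where "g x = (if x \<in> C then 0 else \<infinity>)" for x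
  have "proper_fun g" using assms(3) by (auto simp: proper_fun_def g_def)
  moreover have "lsc_fun g"
    unfolding lsc_fun_def
  proof
    fix x
    show "g x \<le> Liminf (at x) g"
    proof (cases "x \<in> C")
      case True
      then show ?thesis by (intro Liminf_bounded) (simp add: g_def)
    next
      case False
      then have "\<forall>\<^sub>F y in at x. y \<in> - C"
        using assms(1) by (intro eventually_at_in_open') (auto simp: open_Compl)
      then show ?thesis
        by (intro Liminf_bounded) (auto simp: g_def elim: eventually_mono)
    qed
  qed
  moreover have "convex_fun g"
    unfolding convex_fun_def
  proof (intro allI impI)
    fix x y and u v :: real
    assume uv: "0 \<le> u" "0 \<le> v" "u + v = 1"
    have "u *\<^sub>R x + v *\<^sub>R y \<in> C" if "x \<in> C" "y \<in> C"
      using assms(2) that uv by (auto simp: convex_def)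
    moreover have "u = 0 \<or> v = 0 \<or> (0 < u \<and> 0 < v)" using uv by auto
    ultimately show "g (u *\<^sub>R x + v *\<^sub>R y) \<le> ereal u * g x + ereal v * g y"
      using uv by (auto simp: g_def zero_ereal_def[symmetric])
  qed
  ultimately have "\<exists>!x. is_arg_min (tikhonov_functional g 1) (\<lambda>_. True) x"
    by (intro tikhonov_functional_ex1_minimizer[where m = 0]) (auto simp: g_def)
  moreover have "is_arg_min (tikhonov_functional g 1) (\<lambda>_. True) x
      \<longleftrightarrow> is_arg_min norm (\<lambda>y. y \<in> C) x" for x
  proof -
    obtain c where "c \<in> C" using assms(3) by blast
    then show ?thesis
      by (auto simp: is_arg_min_linorder tikhonov_functional_def g_def split: if_splits)
  qed
  ultimately show ?thesis by simp
qed

lemma least_norm_element_is_arg_min: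
  fixes C :: "'a::{real_inner, complete_space} set"
  assumes "closed C" "convex C" "C \<noteq> {}"
  shows "is_arg_min norm (\<lambda>y. y \<in> C) (least_norm_element C)"
  unfolding least_norm_element_def
  by (rule theI'[OF closed_convex_ex1_least_norm[OF assms]])

section \<open>The Tikhonov point and its value\<close>

lemma zero_subgradient_iff:
  "x \<in> op_inverse (subdifferential f) 0 \<longleftrightarrow> f x \<noteq> \<infinity> \<and> (\<forall>y. f x \<le> f y)"
  by (simp add: op_inverse_def subdifferential_def zero_ereal_def[symmetric])

lemma min_value_eq:
  assumes "\<And>y. f s \<le> f y"
  shows "min_value f = f s"
  unfolding min_value_def using assms by (intro Least_equality) auto

lemma tikhonov_point_characterizations:
  fixes f :: "'a::{real_inner, complete_space} \<Rightarrow> ereal"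
  assumes pr: "proper_fun f" and lsc: "lsc_fun f" and cv: "convex_fun f"
    and bound: "\<And>x. ereal m \<le> f x" and e: "\<epsilon> > 0"
  shows "op_inverse (\<lambda>y. subdifferential f y + {\<epsilon> *\<^sub>R y}) 0 = {tikhonov_point f \<epsilon>}"
    and "{x. is_arg_min (tikhonov_functional f \<epsilon>) (\<lambda>_. True) x} = {tikhonov_point f \<epsilon>}"
proof -
  let ?Z = "op_inverse (\<lambda>y. subdifferential f y + {\<epsilon> *\<^sub>R y}) 0"
  have iff: "x \<in> ?Z \<longleftrightarrow> is_arg_min (tikhonov_functional f \<epsilon>) (\<lambda>_. True) x" for x
    by (simp only: op_inverse_regularized_subdifferential_iff
        is_arg_min_tikhonov_functional_iff[OF pr cv e])
  have ex1: "\<exists>!x. x \<in> ?Z"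
    unfolding iff by (rule tikhonov_functional_ex1_minimizer[OF pr lsc cv bound e])
  have "tikhonov_point f \<epsilon> \<in> ?Z"
    unfolding tikhonov_point_def by (rule theI'[OF ex1])
  with ex1 show Z: "?Z = {tikhonov_point f \<epsilon>}" by auto
  then show "{x. is_arg_min (tikhonov_functional f \<epsilon>) (\<lambda>_. True) x} = {tikhonov_point f \<epsilon>}"
    unfolding iff[symmetric] by simp
qed

theorem theorem2:
  fixes f :: "'a::{real_inner, complete_space} \<Rightarrow> ereal"
    and \<rho> :: "real \<Rightarrow> real"
    and S :: "'a set" and xt :: 'a
  defines "S \<equiv> op_inverse (subdifferential f) 0"
    and "xt \<equiv> least_norm_element S"
  assumes "proper_fun f" and "lsc_fun f" and "convex_fun f"
    and "S \<noteq> {}"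
    and "truncately_R_continuous_at_0 (op_inverse (subdifferential f)) \<rho>"
  shows "(\<forall>\<epsilon>>0.
            op_inverse (\<lambda>y. subdifferential f y + {\<epsilon> *\<^sub>R y}) 0 = {tikhonov_point f \<epsilon>} \<and>
            {x. is_arg_min (\<lambda>y. f y + ereal (\<epsilon> / 2 * (norm y)\<^sup>2)) (\<lambda>_. True) x}
              = {tikhonov_point f \<epsilon>}) \<and>
         (\<forall>\<^sub>F \<epsilon> in at_right 0.
            f (tikhonov_point f \<epsilon>) - min_value f
              \<le> ereal (norm xt * \<rho> (\<epsilon> * norm xt) * \<epsilon>))"
proof -
  obtain s0 where s0: "s0 \<in> S" using \<open>S \<noteq> {}\<close> by blast
  then obtain m where m: "f s0 = ereal m" and bound: "\<And>y. ereal m \<le> f y"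
    using \<open>proper_fun f\<close> unfolding S_def zero_subgradient_iff proper_fun_def
    by (cases "f s0") auto
  have S_eq: "S = {x. f x \<le> ereal m}"
    unfolding S_def set_eq_iff zero_subgradient_iff
    using bound m by (auto intro: order_trans) (metis m)
  then have S_val: "f s = ereal m" if "s \<in> S" for s
    using that bound[of s] by auto
  have min: "min_value f = ereal m"
    using min_value_eq[of f s0] bound m by simp
  have "is_arg_min norm (\<lambda>y. y \<in> S) xt"
    unfolding xt_def using \<open>S \<noteq> {}\<close> \<open>lsc_fun f\<close> \<open>convex_fun f\<close>
    by (intro least_norm_element_is_arg_min)
      (auto simp: S_eq closed_sublevel_lsc_fun convex_sublevel_convex_fun)
  then have xt: "xt \<in> S" "\<And>y. y \<in> S \<Longrightarrow> norm xt \<le> norm y"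
    by (auto simp: is_arg_min_linorder)
  then have a: "(INF y\<in>S. norm y) = norm xt"
    by (intro cInf_eq_minimum) auto
  note point = tikhonov_point_characterizations[OF \<open>proper_fun f\<close> \<open>lsc_fun f\<close> \<open>convex_fun f\<close> bound]
  obtain \<sigma> where \<sigma>: "\<sigma> > 0" and trunc: "\<And>x. x \<in> cball 0 \<sigma> \<Longrightarrow>
      op_inverse (subdifferential f) x \<inter> cball 0 (norm xt) \<subseteq> S + cball 0 (\<rho> (norm x))"
    and mono: "mono_on {0..} \<rho>"
    using assms(7) unfolding truncately_R_continuous_at_0_def S_def[symmetric] a by blast
  have est: "f (tikhonov_point f \<epsilon>) - min_value f \<le> ereal (norm xt * \<rho> (\<epsilon> * norm xt) * \<epsilon>)"
    if e: "\<epsilon> > 0" and small: "\<epsilon> * norm xt \<le> \<sigma>" for \<epsilon>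
  proof -
    define x where "x = tikhonov_point f \<epsilon>"
    have sub: "- (\<epsilon> *\<^sub>R x) \<in> subdifferential f x"
      unfolding op_inverse_regularized_subdifferential_iff[symmetric] x_def
      by (simp add: point(1)[OF e])
    have "is_arg_min (tikhonov_functional f \<epsilon>) (\<lambda>_. True) x"
      using point(2)[OF e] x_def by blast
    then have F_le: "tikhonov_functional f \<epsilon> x \<le> tikhonov_functional f \<epsilon> xt"
      by (simp add: is_arg_min_linorder)
    obtain c where c: "f x = ereal c" "m \<le> c"
      using sub bound[of x] by (cases "f x") (auto simp: subdifferential_def)
    have "c + \<epsilon> / 2 * (norm x)\<^sup>2 \<le> m + \<epsilon> / 2 * (norm xt)\<^sup>2"
      using F_le by (simp add: tikhonov_functional_def c S_val[OF xt(1)])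
    then have "\<epsilon> / 2 * (norm x)\<^sup>2 \<le> \<epsilon> / 2 * (norm xt)\<^sup>2" using c(2) by linarith
    then have "(norm x)\<^sup>2 \<le> (norm xt)\<^sup>2"
      using e by (simp add: mult_le_cancel_left_pos)
    then have nx: "norm x \<le> norm xt" by (rule power2_le_imp_le) simp
    then have enx: "\<epsilon> * norm x \<le> \<epsilon> * norm xt" using e by simp
    have norm_sub: "norm (- (\<epsilon> *\<^sub>R x)) = \<epsilon> * norm x" using e by simp
    have "- (\<epsilon> *\<^sub>R x) \<in> cball 0 \<sigma>"
      unfolding mem_cball_0 norm_sub using enx small by linarith
    moreover have "x \<in> op_inverse (subdifferential f) (- (\<epsilon> *\<^sub>R x)) \<inter> cball 0 (norm xt)"
      using sub nx by (simp add: op_inverse_def)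
    ultimately have "x \<in> S + cball 0 (\<rho> (\<epsilon> * norm x))"
      using trunc norm_sub by (metis subsetD)
    then obtain s d where s: "s \<in> S" and d: "norm d \<le> \<rho> (\<epsilon> * norm x)" and xsd: "x = s + d"
      by (auto elim!: set_plus_elim)
    have "\<rho> (\<epsilon> * norm x) \<le> \<rho> (\<epsilon> * norm xt)"
      using mono enx e by (auto intro: mono_onD)
    with d have d': "norm d \<le> \<rho> (\<epsilon> * norm xt)" by linarith
    have "f x + ereal (- (\<epsilon> *\<^sub>R x) \<bullet> (s - x)) \<le> f s"
      using sub by (simp add: subdifferential_def)
    then have "c - m \<le> \<epsilon> * (x \<bullet> (s - x))"
      by (simp add: c S_val[OF s])
    also have "\<dots> = \<epsilon> * (x \<bullet> - d)" by (simp add: xsd)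
    also have "\<dots> \<le> \<epsilon> * (norm x * norm d)"
      using e norm_cauchy_schwarz[of x "- d"] by (intro mult_left_mono) auto
    also have "\<dots> \<le> \<epsilon> * (norm xt * \<rho> (\<epsilon> * norm xt))"
      using e nx d' by (intro mult_left_mono mult_mono) auto
    finally show ?thesis
      unfolding min x_def[symmetric] c(1) by (simp add: mult_ac)
  qed
  have "((\<lambda>\<epsilon>. \<epsilon> * norm xt) \<longlongrightarrow> 0 * norm xt) (at_right 0)"
    by (intro tendsto_intros)
  then have "\<forall>\<^sub>F \<epsilon> in at_right 0. \<epsilon> * norm xt < \<sigma>"
    using \<sigma> by (intro order_tendstoD) auto
  then have "\<forall>\<^sub>F \<epsilon> in at_right 0.
      f (tikhonov_point f \<epsilon>) - min_value f \<le> ereal (norm xt * \<rho> (\<epsilon> * norm xt) * \<epsilon>)"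
    using eventually_at_right_less[of "0::real"]
    by eventually_elim (rule est, auto)
  moreover have "tikhonov_functional f \<epsilon> = (\<lambda>y. f y + ereal (\<epsilon> / 2 * (norm y)\<^sup>2))" for \<epsilon>
    by (simp add: fun_eq_iff tikhonov_functional_def)
  ultimately show ?thesis
    using point by (simp only:) auto
qed

end
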